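(* Let $n_1,\ldots,n_t$ be positive integers, and let $t_e$ and $t_o$ be respectively the number of even and odd integers in the sequence $(n_1,\ldots,n_t)$. Let $m$ be a positive integer and $N=82\times35^{2^{t_o}-2}\times 81^{t_e}m$, and suppose that $m\geq n_i\geq 2(\lceil \log N \rceil+1)$ for each $1\leq i\leq t$. Then $$R(C_{n_1},\ldots,C_{n_t},K_{m,m})\leq N.$$
   Context: $C_k$ denotes the cycle on $k$ vertices and $K_{m,m}$ the complete bipartite graph with both parts of size $m$. For graphs $G_1,\ldots,G_k$, the Ramsey number $R(G_1,\ldots,G_k)$ is the smallest integer $N$ such that for every coloring of the edges of the complete graph $K_N$ with colors $1,\ldots,k$ there is, for some $i$, a copy of $G_i$ all of whose edges have color $i$. $\log$ denotes the logarithm to base $2$. *)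

theory Defs
  imports Complex_Main
begin

text \<open>A finite simple graph is given by a vertex set and a set of edges (2-element sets).
  All graphs here have natural-number vertices.\<close>
type_synonym graph = "nat set \<times> nat set set"

definition cycle_graph :: "nat \<Rightarrow> graph" where
  "cycle_graph k = ({0..<k}, {{j, (j + 1) mod k} | j. j < k})"

definition complete_bipartite :: "nat \<Rightarrow> graph" where
  "complete_bipartite m = ({0..<2*m}, {{a, m + b} | a b. a < m \<and> b < m})"

text \<open>An edge colouring of the complete graph on vertex set {0..<N} with colours
  0..<k (colour i corresponds to colour i+1 of the paper).\<close>
definition is_coloring :: "nat \<Rightarrow> nat \<Rightarrow> (nat \<Rightarrow> nat \<Rightarrow> nat) \<Rightarrow> bool" where
  "is_coloring N k c \<longleftrightarrow>
     (\<forall>x y. x < N \<longrightarrow> y < N \<longrightarrow> x \<noteq> y \<longrightarrow> c x y = c y x \<and> c x y < k)"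

definition mono_copy :: "nat \<Rightarrow> (nat \<Rightarrow> nat \<Rightarrow> nat) \<Rightarrow> nat \<Rightarrow> graph \<Rightarrow> bool" where
  "mono_copy N c i H \<longleftrightarrow>
     (\<exists>f. inj_on f (fst H) \<and> f ` fst H \<subseteq> {..<N} \<and>
          (\<forall>u v. u \<in> fst H \<longrightarrow> v \<in> fst H \<longrightarrow> u \<noteq> v \<longrightarrow> {u, v} \<in> snd H \<longrightarrow> c (f u) (f v) = i))"

definition ramsey_prop :: "graph list \<Rightarrow> nat \<Rightarrow> bool" where
  "ramsey_prop Gs N \<longleftrightarrow>
     (\<forall>c. is_coloring N (length Gs) c \<longrightarrow> (\<exists>i < length Gs. mono_copy N c i (Gs ! i)))"

definition ramsey_number :: "graph list \<Rightarrow> nat" where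
  "ramsey_number Gs = (LEAST N. ramsey_prop Gs N)"

end

theory Submission
  imports Defs
begin

text \<open>Call a pair of sets of size \<open>M\<close> with no edge between them a hole. Suppose that a graph has no
  hole between disjoint sets \<open>A\<close> and \<open>B\<close> of size at least \<open>22 M\<close>. A depth-first search finds a path on
  \<open>5 M\<close> vertices, and outside of it there are two disjoint regions in which every set of at most \<open>M\<close>
  vertices of one side has three times as many neighbours. All but few vertices of the path are
  adjacent to both regions, so two of them at any prescribed odd distance \<open>k \<le> M\<close> along the path start
  binary trees of depth \<open>h = \<lceil>log M\<rceil>\<close> in the two regions. The sets of leaves have size at least \<open>M\<close> and
  lie on different sides, hence an edge between them closes a cycle of length \<open>k + 2 h + 3\<close>; if there is
  a third set of size \<open>2 M\<close> without holes to \<open>A\<close> and \<open>B\<close>, then a common neighbour in it closes a cycle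
  of length \<open>k + 2 h + 4\<close>.

  So a colour without its even cycle has a hole in every large pair of sets, and passing to that
  hole costs a constant factor. A colour without its odd cycle has a hole in one of the pairs of
  every large triple of sets; such a triple, with all pairs free of the odd colours treated so far,
  is produced by a nested application of the induction hypothesis, which squares the cost.
  Eliminating first the odd and then the even colours leaves a complete bipartite graph in the
  last colour.\<close>

section \<open>Paths, holes and depth-first search\<close>

definition path :: "('a \<Rightarrow> 'a \<Rightarrow> bool) \<Rightarrow> 'a list \<Rightarrow> bool" where
  "path E p \<longleftrightarrow> distinct p \<and> successively E p"

definition no_hole :: "('a \<Rightarrow> 'a \<Rightarrow> bool) \<Rightarrow> nat \<Rightarrow> 'a set \<Rightarrow> 'a set \<Rightarrow> bool" where
  "no_hole E M A B \<longleftrightarrow>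
     (\<forall>S T. S \<subseteq> A \<longrightarrow> T \<subseteq> B \<longrightarrow> M \<le> card S \<longrightarrow> M \<le> card T \<longrightarrow> (\<exists>s\<in>S. \<exists>t\<in>T. E s t))"

definition nbrs :: "('a \<Rightarrow> 'a \<Rightarrow> bool) \<Rightarrow> 'a set \<Rightarrow> 'a set \<Rightarrow> 'a set" where
  "nbrs E Z Q = {q \<in> Q. \<exists>z\<in>Z. E z q}"

lemma no_holeD:
  "no_hole E M A B \<Longrightarrow> S \<subseteq> A \<Longrightarrow> T \<subseteq> B \<Longrightarrow> M \<le> card S \<Longrightarrow> M \<le> card T \<Longrightarrow> \<exists>s\<in>S. \<exists>t\<in>T. E s t"
  unfolding no_hole_def by blast

lemma no_hole_mono: "no_hole E M A B \<Longrightarrow> A' \<subseteq> A \<Longrightarrow> B' \<subseteq> B \<Longrightarrow> no_hole E M A' B'"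
  unfolding no_hole_def by (meson order_trans)

lemma no_hole_sym: "symp E \<Longrightarrow> no_hole E M A B \<Longrightarrow> no_hole E M B A"
  unfolding no_hole_def by (meson sympD)

lemma path_Cons:
  assumes "path E p" "u \<notin> set p" "p \<noteq> [] \<Longrightarrow> E u (hd p)"
  shows "path E (u # p)"
  using assms by (auto simp: path_def successively_Cons)

lemma path_append:
  assumes "path E p" "path E q" "set p \<inter> set q = {}" "p \<noteq> [] \<Longrightarrow> q \<noteq> [] \<Longrightarrow> E (last p) (hd q)"
  shows "path E (p @ q)"
  using assms by (auto simp: path_def successively_append_iff)

lemma path_rev: "symp E \<Longrightarrow> path E p \<Longrightarrow> path E (rev p)"
  by (auto simp: path_def intro: successively_mono dest: sympD)

lemma path_take: "path E p \<Longrightarrow> path E (take k p)"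
  by (metis append_take_drop_id path_def distinct_take successively_append_iff)

lemma path_drop: "path E p \<Longrightarrow> path E (drop k p)"
  by (metis append_take_drop_id path_def distinct_drop successively_append_iff)

text \<open>A depth-first search, stopped when \<open>s\<close> vertices have been exhausted; \<open>p\<close> is its stack.\<close>
lemma dfs_split:
  assumes fin: "finite V" and sym: "symp E" and "s \<le> card V"
  shows "\<exists>S p. S \<subseteq> V \<and> card S = s \<and> set p \<subseteq> V \<and> set p \<inter> S = {} \<and> path E p
           \<and> (\<forall>x\<in>S. \<forall>y\<in>V - S - set p. \<not> E x y)"
  using \<open>s \<le> card V\<close>
proof (induction s)
  case 0
  show ?case by (rule exI[of _ "{}"], rule exI[of _ "[]"]) (auto simp: path_def)
next
  case (Suc s)
  let ?Q = "\<lambda>(S, p). S \<subseteq> V \<and> card S = s \<and> set p \<subseteq> V \<and> set p \<inter> S = {} \<and> path E p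
           \<and> (\<forall>x\<in>S. \<forall>y\<in>V - S - set p. \<not> E x y)"
  \<comment> \<open>Choose a state whose stack is longest. It admits no further push, so the top
    vertex of the stack has no unvisited neighbour left and can be moved to
    \<open>S\<close>.\<close>
  from Suc obtain S0 p0 where "?Q (S0, p0)" by auto
  moreover have "\<forall>z. ?Q z \<longrightarrow> length (snd z) < Suc (card V)"
    using fin by (auto simp: path_def less_Suc_eq_le) (metis card_mono distinct_card)
  ultimately have "\<exists>z. ?Q z \<and> (\<forall>y. ?Q y \<longrightarrow> length (snd y) \<le> length (snd z))"
    by (rule Lattices_Big.ex_has_greatest_nat)
  then obtain S p where Q: "?Q (S, p)" and mx: "\<And>S' p'. ?Q (S', p') \<Longrightarrow> length p' \<le> length p"
    by force
  have no: False if "u \<in> V - S - set p" "p \<noteq> [] \<Longrightarrow> E u (hd p)" for u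
  proof -
    have "?Q (S, u # p)" using Q that path_Cons[of E p u] by auto
    from mx[OF this] show False by simp
  qed
  \<comment> \<open>On an empty stack any unvisited vertex could be pushed, so \<open>S\<close>
    would be all of \<open>V\<close>, against \<open>card S = s < card V\<close>.\<close>
  have "p \<noteq> []"
  proof
    assume "p = []"
    with no Q have "V \<subseteq> S" by auto
    with Q have "V = S" by auto
    with Q Suc.prems show False by simp
  qed
  then obtain u q where p: "p = u # q" by (cases p) auto
  have fS: "finite S" using Q fin finite_subset by auto
  have "\<forall>y\<in>V - insert u S - set q. \<not> E u y"
    using no p Q sym by (auto dest: sympD)
  with Q p fS show ?case
    by (intro exI[of _ "insert u S"] exI[of _ q]) (auto simp: path_def successively_Cons)
qed

text \<open>Stop the search when \<open>2 * M\<close> vertices are exhausted. At least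
  \<open>M\<close> of them lie on one side, so fewer than \<open>M\<close> vertices of the other
  side are unvisited. Of the \<open>L + 3 * M\<close> vertices there, at most \<open>2 * M\<close>
  are exhausted, and at least \<open>L\<close> must be on the stack.\<close>

lemma long_path:
  assumes fin: "finite A" "finite B" and dis: "A \<inter> B = {}" and sym: "symp E"
    and hole: "no_hole E M A B" and card: "L + 3 * M \<le> card A" "L + 3 * M \<le> card B"
  shows "\<exists>p. path E p \<and> set p \<subseteq> A \<union> B \<and> length p = L"
proof -
  have cAB: "card (A \<union> B) = card A + card B" using fin dis by (simp add: card_Un_disjoint)
  obtain S p where S: "S \<subseteq> A \<union> B" "card S = 2 * M" and p: "set p \<subseteq> A \<union> B" "set p \<inter> S = {}" "path E p"
    and no: "\<forall>x\<in>S. \<forall>y\<in>A \<union> B - S - set p. \<not> E x y"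
    using dfs_split[of "A \<union> B" E "2 * M"] fin sym card cAB by auto
  have fS: "finite S" using S fin finite_subset by blast
  have large: "L \<le> length p" if X: "X \<subseteq> A \<union> B" "finite X" "L + 3 * M \<le> card X"
      and Y: "M \<le> card (S \<inter> Y)" and YX: "no_hole E M Y X" for X Y
  proof -
    let ?U = "X - S - set p"
    have "card ?U < M"
    proof (rule ccontr)
      assume "\<not> ?thesis"
      then obtain s t where "s \<in> S \<inter> Y" "t \<in> ?U" "E s t"
        using no_holeD[OF YX, of "S \<inter> Y" ?U] Y by auto
      with no X show False by blast
    qed
    moreover have "X \<subseteq> ?U \<union> S \<union> set p" by auto
    then have "card X \<le> card (?U \<union> S \<union> set p)" using X fS by (intro card_mono) auto
    then have "card X \<le> card ?U + card S + card (set p)"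
      by (meson card_Un_le add_mono le_trans order_refl)
    ultimately show ?thesis using X S card_length[of p] by simp
  qed
  have "card S \<le> card (S \<inter> A) + card (S \<inter> B)"
    using S by (metis card_Un_le inf_sup_distrib1 le_iff_inf)
  then consider "M \<le> card (S \<inter> A)" | "M \<le> card (S \<inter> B)" using S by linarith
  then have "L \<le> length p"
    using large[of B A] large[of A B] fin card hole no_hole_sym[OF sym hole] by cases auto
  then show ?thesis using p path_take[of E p L] set_take_subset[of L p]
    by (intro exI[of _ "take L p"]) auto
qed

section \<open>Expanding subgraphs and binary trees\<close>

text \<open>Discard poorly expanding sets \<open>X\<close> and \<open>Y\<close>, each smaller than
  \<open>M\<close>, of largest total size. A set \<open>Z\<close> violating expansion in the rest
  could join \<open>X\<close>. Unless this contradicts maximality, \<open>X \<union> Z\<close> has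
  at least \<open>M\<close> and fewer than \<open>2 * M\<close> vertices, hence fewer than
  \<open>6 * M\<close> neighbours and fewer than \<open>M\<close> non-neighbours, while more than
  \<open>7 * M\<close> vertices remain on the other side. The argument for \<open>Y\<close> is the
  same.\<close>

lemma prune:
  assumes fin: "finite P0" "finite Q0" and sym: "symp E" and hole: "no_hole E M P0 Q0"
    and card: "8 * M \<le> card P0" "8 * M \<le> card Q0" and "M > 0"
  shows "\<exists>P Q. P \<subseteq> P0 \<and> Q \<subseteq> Q0 \<and> M \<le> card P \<and> M \<le> card Q
           \<and> (\<forall>Z\<subseteq>P. card Z \<le> M \<longrightarrow> 3 * card Z \<le> card (nbrs E Z Q))
           \<and> (\<forall>Z\<subseteq>Q. card Z \<le> M \<longrightarrow> 3 * card Z \<le> card (nbrs E Z P))"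
proof -
  let ?B = "\<lambda>(X, Y). X \<subseteq> P0 \<and> Y \<subseteq> Q0 \<and> card X < M \<and> card Y < M
     \<and> card (nbrs E X (Q0 - Y)) \<le> 3 * card X \<and> card (nbrs E Y (P0 - X)) \<le> 3 * card Y"
  have "?B ({}, {})" using \<open>M > 0\<close> by (auto simp: nbrs_def)
  moreover have "\<forall>z. ?B z \<longrightarrow> card (fst z) + card (snd z) < 2 * M" by auto
  ultimately have "\<exists>z. ?B z \<and> (\<forall>y. ?B y \<longrightarrow> card (fst y) + card (snd y) \<le> card (fst z) + card (snd z))"
    by (rule Lattices_Big.ex_has_greatest_nat)
  then obtain X Y where B: "?B (X, Y)"
    and mx: "\<And>X' Y'. ?B (X', Y') \<Longrightarrow> card X' + card Y' \<le> card X + card Y" by force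
  have fXY: "finite X" "finite Y" using B fin finite_subset by auto
  have cPQ: "7 * M < card (P0 - X)" "7 * M < card (Q0 - Y)"
    using B card fXY by (auto simp: card_Diff_subset)
  \<comment> \<open>Stated for abstract sides \<open>F\<close> and \<open>G\<close>, because it is
    applied with \<open>P0\<close> and \<open>Q0\<close> in either role.\<close>
  have key: False
    if F: "finite F" "X1 \<subseteq> F" and fG: "finite G" and h: "no_hole E M F G"
      and Z: "Z \<subseteq> F - X1" "card Z \<le> M" "card (nbrs E Z (G - Y1)) < 3 * card Z"
      and X1: "card X1 < M" "card (nbrs E X1 (G - Y1)) \<le> 3 * card X1"
      and big: "7 * M < card (G - Y1)"
      and max: "card (X1 \<union> Z) < M \<Longrightarrow> card (nbrs E (X1 \<union> Z) (G - Y1)) \<le> 3 * card (X1 \<union> Z)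
                \<Longrightarrow> card (X1 \<union> Z) \<le> card X1" for F G X1 Y1 Z
  proof -
    have fin': "finite X1" "finite Z" using F Z finite_subset by blast+
    have cU: "card (X1 \<union> Z) = card X1 + card Z" using fin' Z by (intro card_Un_disjoint) auto
    have "nbrs E (X1 \<union> Z) (G - Y1) = nbrs E X1 (G - Y1) \<union> nbrs E Z (G - Y1)"
      by (auto simp: nbrs_def)
    then have "card (nbrs E (X1 \<union> Z) (G - Y1)) \<le> card (nbrs E X1 (G - Y1)) + card (nbrs E Z (G - Y1))"
      by (simp add: card_Un_le)
    then have le: "card (nbrs E (X1 \<union> Z) (G - Y1)) \<le> 3 * card (X1 \<union> Z)" using Z X1 cU by simp
    show False
    proof (cases "card (X1 \<union> Z) < M")
      case True
      with max le cU Z show False by simp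
    next
      case False
      let ?R = "G - Y1 - nbrs E (X1 \<union> Z) (G - Y1)"
      have "card ?R < M"
      proof (rule ccontr)
        assume "\<not> ?thesis"
        then obtain s t where "s \<in> X1 \<union> Z" "t \<in> ?R" "E s t"
          using no_holeD[OF h, of "X1 \<union> Z" ?R] F Z False by auto
        then show False by (auto simp: nbrs_def)
      qed
      moreover have "card (G - Y1) \<le> card ?R + card (nbrs E (X1 \<union> Z) (G - Y1))"
        using diff_card_le_card_Diff[of "nbrs E (X1 \<union> Z) (G - Y1)" "G - Y1"] fG
        by (auto simp: nbrs_def)
      ultimately show False using le cU X1 Z big by simp
    qed
  qed
  \<comment> \<open>Enlarging the discarded set on one side shrinks the set in which the neighbours
    of the other discarded set are counted, so the condition on the latter survives.\<close>
  have sub: "card (nbrs E S (T - (R \<union> Z))) \<le> card (nbrs E S (T - R))" if "finite T" for S T R Z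
    using that by (intro card_mono) (auto simp: nbrs_def)
  show ?thesis
  proof (rule exI[of _ "P0 - X"], rule exI[of _ "Q0 - Y"], intro conjI allI impI)
    fix Z assume Z: "Z \<subseteq> P0 - X" "card Z \<le> M"
    show "3 * card Z \<le> card (nbrs E Z (Q0 - Y))"
    proof (rule ccontr)
      assume n: "\<not> ?thesis"
      show False
      proof (rule key[of P0 X Q0 Z Y])
        assume "card (X \<union> Z) < M" "card (nbrs E (X \<union> Z) (Q0 - Y)) \<le> 3 * card (X \<union> Z)"
        then have "?B (X \<union> Z, Y)" using B Z sub[OF fin(1), of Y X Z] by auto
        from mx[OF this] show "card (X \<union> Z) \<le> card X" by simp
      qed (use n B Z fin hole cPQ in auto)
    qed
  next
    fix Z assume Z: "Z \<subseteq> Q0 - Y" "card Z \<le> M"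
    show "3 * card Z \<le> card (nbrs E Z (P0 - X))"
    proof (rule ccontr)
      assume n: "\<not> ?thesis"
      show False
      proof (rule key[of Q0 Y P0 Z X])
        assume "card (Y \<union> Z) < M" "card (nbrs E (Y \<union> Z) (P0 - X)) \<le> 3 * card (Y \<union> Z)"
        then have "?B (X, Y \<union> Z)" using B Z sub[OF fin(2), of X Y Z] by auto
        from mx[OF this] show "card (Y \<union> Z) \<le> card Y" by simp
      qed (use n B Z fin no_hole_sym[OF sym hole] cPQ in auto)
    qed
  qed (use cPQ in auto)
qed

text \<open>Level \<open>j\<close> of a binary tree rooted at \<open>x\<close>, embedded level by level; \<open>U\<close> is the set of
  vertices used so far. The side to which the next level belongs contains at most \<open>2 ^ j\<close> of them,
  which is why threefold expansion suffices for doubling.\<close>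
lemma tree_levels:
  fixes sd :: "nat \<Rightarrow> 'a set"
  assumes fin: "\<And>j. finite (sd j)" and per: "\<And>j. sd (Suc (Suc j)) = sd j"
    and dis: "sd 0 \<inter> sd 1 = {}" and sym: "symp E"
    and exp: "\<And>j Z. Z \<subseteq> sd j \<Longrightarrow> card Z \<le> M \<Longrightarrow> 3 * card Z \<le> card (nbrs E Z (sd (Suc j)))"
    and x: "x \<in> sd 0" and pow: "\<And>i. i < j \<Longrightarrow> 2 ^ i \<le> M"
  shows "\<exists>L U. L \<subseteq> U \<and> L \<subseteq> sd j \<and> U \<subseteq> sd 0 \<union> sd 1 \<and> card L = 2 ^ j
     \<and> card (U \<inter> sd (Suc j)) \<le> 2 ^ j \<and> card (U \<inter> sd j) \<le> 2 ^ Suc j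
     \<and> (\<forall>y\<in>L. \<exists>p. path E p \<and> p \<noteq> [] \<and> hd p = y \<and> last p = x \<and> length p = Suc j \<and> set p \<subseteq> U)"
  using pow
proof (induction j)
  case 0
  have "{x} \<inter> sd 1 = {}" "{x} \<inter> sd 0 = {x}" using x dis by auto
  moreover have "path E [x]" by (simp add: path_def)
  ultimately show ?case using x
    by (intro exI[of _ "{x}"]) (auto intro!: exI[of _ "[x]"])
next
  case (Suc j)
  from Suc.IH Suc.prems obtain L U where L: "L \<subseteq> U" "L \<subseteq> sd j" "U \<subseteq> sd 0 \<union> sd 1" "card L = 2 ^ j"
    "card (U \<inter> sd (Suc j)) \<le> 2 ^ j" "card (U \<inter> sd j) \<le> 2 ^ Suc j"
    and paths: "\<And>y. y \<in> L \<Longrightarrow>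
       \<exists>p. path E p \<and> p \<noteq> [] \<and> hd p = y \<and> last p = x \<and> length p = Suc j \<and> set p \<subseteq> U"
    by (metis less_Suc_eq)
  have sd01: "sd i \<subseteq> sd 0 \<union> sd 1 \<and> sd (Suc i) \<subseteq> sd 0 \<union> sd 1 \<and> sd i \<inter> sd (Suc i) = {}" for i
    by (induction i) (use dis per in auto)
  let ?W = "nbrs E L (sd (Suc j)) - U"
  have "nbrs E L (sd (Suc j)) \<subseteq> ?W \<union> (U \<inter> sd (Suc j))" by (auto simp: nbrs_def)
  then have "card (nbrs E L (sd (Suc j))) \<le> card (?W \<union> (U \<inter> sd (Suc j)))"
    using fin by (intro card_mono) (auto simp: nbrs_def)
  also have "\<dots> \<le> card ?W + card (U \<inter> sd (Suc j))" by (rule card_Un_le)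
  finally have "2 ^ Suc j \<le> card ?W"
    using exp[OF L(2)] L Suc.prems[of j] by simp
  then obtain L' where L': "L' \<subseteq> ?W" "card L' = 2 ^ Suc j" "finite L'"
    by (metis obtain_subset_with_card_n)
  have L'sd: "L' \<subseteq> sd (Suc j)" using L' by (auto simp: nbrs_def)
  \<comment> \<open>The side of level \<open>j\<close> receives nothing, so its old bound
    \<open>2 ^ Suc j\<close> is the one needed before the next doubling. The other side holds at
    most \<open>2 ^ j + 2 ^ Suc j\<close> vertices, below the allowed
    \<open>2 ^ Suc (Suc j)\<close>.\<close>
  have 1: "(U \<union> L') \<inter> sd (Suc (Suc j)) = U \<inter> sd j" using L'sd sd01[of j] per by auto
  have 2: "(U \<union> L') \<inter> sd (Suc j) = (U \<inter> sd (Suc j)) \<union> L'" using L'sd by auto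
  have 3: "card ((U \<inter> sd (Suc j)) \<union> L') \<le> 2 ^ j + 2 ^ Suc j"
    using card_Un_le[of "U \<inter> sd (Suc j)" L'] L L' by simp
  have 4: "\<exists>p. path E p \<and> p \<noteq> [] \<and> hd p = y \<and> last p = x \<and> length p = Suc (Suc j) \<and> set p \<subseteq> U \<union> L'"
    if y: "y \<in> L'" for y
  proof -
    obtain z where z: "z \<in> L" "E z y" using y L' by (auto simp: nbrs_def)
    then obtain p where p: "path E p" "p \<noteq> []" "hd p = z" "last p = x" "length p = Suc j" "set p \<subseteq> U"
      using paths by blast
    have "path E (y # p)" using p z y L' sym by (intro path_Cons) (auto dest: sympD)
    then show ?thesis using p y by (intro exI[of _ "y # p"]) auto
  qed
  show ?case
    by (rule exI[of _ L'], rule exI[of _ "U \<union> L'"])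
      (use 1 2 3 4 L L' L'sd sd01[of "Suc j"] in auto)
qed

definition reached :: "('a \<Rightarrow> 'a \<Rightarrow> bool) \<Rightarrow> 'a set \<Rightarrow> nat \<Rightarrow> 'a \<Rightarrow> 'a set \<Rightarrow> bool" where
  "reached E W h x L \<longleftrightarrow>
     (\<forall>y\<in>L. \<exists>p. path E p \<and> p \<noteq> [] \<and> hd p = y \<and> last p = x \<and> length p = Suc h \<and> set p \<subseteq> W)"

text \<open>The conditions on \<open>h\<close> balance two demands: every level above the leaves has
  at most \<open>M\<close> vertices, so expansion applies to it, and there are at least
  \<open>M\<close> leaves, so the hole condition applies to them.\<close>

lemma reached_in_expander:
  assumes fin: "finite P" "finite Q" and dis: "P \<inter> Q = {}" and sym: "symp E"
    and exp: "\<forall>Z\<subseteq>P. card Z \<le> M \<longrightarrow> 3 * card Z \<le> card (nbrs E Z Q)"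
      "\<forall>Z\<subseteq>Q. card Z \<le> M \<longrightarrow> 3 * card Z \<le> card (nbrs E Z P)"
    and x: "x \<in> P" and h: "M \<le> 2 ^ h" "\<forall>i<h. 2 ^ i \<le> M"
  shows "\<exists>L. L \<subseteq> (if even h then P else Q) \<and> M \<le> card L \<and> reached E (P \<union> Q) h x L"
proof -
  let ?sd = "\<lambda>j::nat. if even j then P else Q"
  have "\<exists>L U. L \<subseteq> U \<and> L \<subseteq> ?sd h \<and> U \<subseteq> ?sd 0 \<union> ?sd 1 \<and> card L = 2 ^ h
     \<and> card (U \<inter> ?sd (Suc h)) \<le> 2 ^ h \<and> card (U \<inter> ?sd h) \<le> 2 ^ Suc h
     \<and> (\<forall>y\<in>L. \<exists>p. path E p \<and> p \<noteq> [] \<and> hd p = y \<and> last p = x \<and> length p = Suc h \<and> set p \<subseteq> U)"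
    by (rule tree_levels[where M = M and E = E and sd = ?sd]) (use assms in auto)
  then obtain L U where LU: "L \<subseteq> ?sd h" "U \<subseteq> P \<union> Q" "card L = 2 ^ h"
    "\<forall>y\<in>L. \<exists>p. path E p \<and> p \<noteq> [] \<and> hd p = y \<and> last p = x \<and> length p = Suc h \<and> set p \<subseteq> U"
    by auto
  have "reached E (P \<union> Q) h x L" unfolding reached_def using LU(2,4) by (meson order_trans)
  with LU h show ?thesis by metis
qed

lemma reached_mono: "reached E W h x L \<Longrightarrow> W \<subseteq> W' \<Longrightarrow> reached E W' h x L"
  unfolding reached_def by (meson order_trans)

text \<open>Of the pruned graph only its use is kept: \<open>P\<close> and \<open>Q\<close> are
  large enough to be entered from most vertices outside, and each of their vertices is the root of a
  tree. The leaves lie on the side of the root exactly if \<open>h\<close> is even.\<close>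

lemma expanding_region:
  assumes fin: "finite A" "finite B" and dis: "A \<inter> B = {}" and sym: "symp E"
    and hole: "no_hole E M A B" and card: "8 * M \<le> card A" "8 * M \<le> card B" and "M > 0"
    and h: "M \<le> 2 ^ h" "\<forall>i<h. 2 ^ i \<le> M"
  shows "\<exists>P Q. P \<subseteq> A \<and> Q \<subseteq> B \<and> M \<le> card P \<and> M \<le> card Q
     \<and> (\<forall>x\<in>P. \<exists>L. L \<subseteq> (if even h then A else B) \<and> M \<le> card L \<and> reached E (A \<union> B) h x L)
     \<and> (\<forall>x\<in>Q. \<exists>L. L \<subseteq> (if even h then B else A) \<and> M \<le> card L \<and> reached E (A \<union> B) h x L)"
proof -
  obtain P Q where PQ: "P \<subseteq> A" "Q \<subseteq> B" "M \<le> card P" "M \<le> card Q"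
     and exp: "\<forall>Z\<subseteq>P. card Z \<le> M \<longrightarrow> 3 * card Z \<le> card (nbrs E Z Q)"
      "\<forall>Z\<subseteq>Q. card Z \<le> M \<longrightarrow> 3 * card Z \<le> card (nbrs E Z P)"
    using prune[OF fin sym hole card \<open>M > 0\<close>] by metis
  have f: "finite P" "finite Q" "P \<inter> Q = {}" "Q \<inter> P = {}" "P \<union> Q \<subseteq> A \<union> B" "Q \<union> P \<subseteq> A \<union> B"
    using PQ fin dis finite_subset by auto
  have a: "\<exists>L. L \<subseteq> (if even h then A else B) \<and> M \<le> card L \<and> reached E (A \<union> B) h x L" if "x \<in> P" for x
  proof -
    from reached_in_expander[OF f(1,2,3) sym exp that h]
    obtain L where "L \<subseteq> (if even h then P else Q)" "M \<le> card L" "reached E (P \<union> Q) h x L"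
      by (elim exE conjE)
    moreover from this(1) have "L \<subseteq> (if even h then A else B)" using PQ(1,2) by (cases "even h") auto
    ultimately show ?thesis using reached_mono[OF _ f(5)] by (intro exI[of _ L] conjI)
  qed
  have b: "\<exists>L. L \<subseteq> (if even h then B else A) \<and> M \<le> card L \<and> reached E (A \<union> B) h x L" if "x \<in> Q" for x
  proof -
    from reached_in_expander[OF f(2,1,4) sym exp(2,1) that h]
    obtain L where "L \<subseteq> (if even h then Q else P)" "M \<le> card L" "reached E (Q \<union> P) h x L"
      by (elim exE conjE)
    moreover from this(1) have "L \<subseteq> (if even h then B else A)" using PQ(1,2) by (cases "even h") auto
    ultimately show ?thesis using reached_mono[OF _ f(6)] by (intro exI[of _ L] conjI)
  qed
  show ?thesis by (rule exI[of _ P], rule exI[of _ Q], intro conjI ballI PQ a b)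
qed

section \<open>Paths of prescribed length between two large sets\<close>

lemma successively_nth: "successively R p \<Longrightarrow> Suc i < length p \<Longrightarrow> R (p ! i) (p ! Suc i)"
proof (induction p arbitrary: i)
  case (Cons a p)
  then show ?case by (cases i) (auto simp: successively_Cons hd_conv_nth)
qed simp

lemma alternating_nth:
  assumes "successively R p" and R: "\<And>x y. R x y \<Longrightarrow> x \<in> A \<and> y \<in> B \<or> x \<in> B \<and> y \<in> A"
    and dis: "A \<inter> B = {}" and "p ! i \<in> A" "i + j < length p"
  shows "p ! (i + j) \<in> (if even j then A else B)"
  using assms(5)
proof (induction j)
  case (Suc j)
  then show ?case using R[OF successively_nth[OF assms(1), of "i + j"]] dis by (auto split: if_splits)
qed (use assms in simp)

lemma two_disjoint_subsets:
  assumes "finite A" "2 * s \<le> card A"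
  shows "\<exists>A1 A2. A1 \<subseteq> A \<and> A2 \<subseteq> A \<and> A1 \<inter> A2 = {} \<and> s \<le> card A1 \<and> s \<le> card A2"
proof -
  obtain A1 where A1: "A1 \<subseteq> A" "card A1 = s" "finite A1"
    using obtain_subset_with_card_n[of s A] assms by (metis le_add1 mult_2 order_trans)
  then have "s \<le> card (A - A1)" using assms by (simp add: card_Diff_subset)
  show ?thesis
    by (rule exI[of _ A1], rule exI[of _ "A - A1"]) (use A1 \<open>s \<le> card (A - A1)\<close> in auto)
qed

text \<open>A path on \<open>5 * M\<close> vertices allows \<open>4 * M\<close> starting positions
  with a shift of \<open>k \<le> M\<close>. Removing it leaves at least \<open>17 * M\<close>
  vertices on each side, enough for two disjoint regions with sides of size
  \<open>8 * M\<close>.\<close>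

lemma connecting_paths:
  assumes fin: "finite A" "finite B" and dis: "A \<inter> B = {}" and sym: "symp E"
    and hole: "no_hole E M A B" and card: "22 * M \<le> card A" "22 * M \<le> card B" and "M > 0"
    and h: "M \<le> 2 ^ h" "\<forall>i<h. 2 ^ i \<le> M" and k: "odd k" "k \<le> M"
  shows "\<exists>L1 L2. L1 \<subseteq> A \<and> L2 \<subseteq> B \<and> M \<le> card L1 \<and> M \<le> card L2 \<and>
    (\<forall>x\<in>L1. \<forall>y\<in>L2. \<exists>p. path E p \<and> set p \<subseteq> A \<union> B \<and> p \<noteq> [] \<and> length p = 2 * h + k + 3
        \<and> hd p = x \<and> last p = y)"
proof -
  \<comment> \<open>Restricting to edges between \<open>A\<close> and \<open>B\<close> makes the
    path alternate, so vertices at odd distance along it lie on opposite sides.\<close>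
  let ?F = "\<lambda>x y. E x y \<and> (x \<in> A \<and> y \<in> B \<or> x \<in> B \<and> y \<in> A)"
  have symF: "symp ?F" using sym by (auto simp: symp_def)
  have holeF: "no_hole ?F M A B"
    unfolding no_hole_def
  proof (intro allI impI)
    fix S T assume "S \<subseteq> A" "T \<subseteq> B" "M \<le> card S" "M \<le> card T"
    with no_holeD[OF hole this] show "\<exists>s\<in>S. \<exists>t\<in>T. ?F s t" by blast
  qed
  obtain p where pF: "path ?F p" and p: "set p \<subseteq> A \<union> B" "length p = 5 * M"
    using long_path[OF fin dis symF holeF, of "5 * M"] card by auto
  have pE: "path E p" using pF by (auto simp: path_def intro: successively_mono)
  have distp: "distinct p" using pE by (simp add: path_def)
  have split: "\<exists>A1 A2. A1 \<subseteq> X - set p \<and> A2 \<subseteq> X - set p \<and> A1 \<inter> A2 = {} \<and> 8 * M \<le> card A1 \<and> 8 * M \<le> card A2"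
    if "finite X" "22 * M \<le> card X" for X
  proof -
    have "card X - card (set p) \<le> card (X - set p)" by (rule diff_card_le_card_Diff) simp
    then have "2 * (8 * M) \<le> card (X - set p)" using that p card_length[of p] by simp
    then show ?thesis using two_disjoint_subsets[of "X - set p" "8 * M"] that by auto
  qed
  obtain A1 A2 where A12: "A1 \<subseteq> A - set p" "A2 \<subseteq> A - set p" "A1 \<inter> A2 = {}" "8 * M \<le> card A1" "8 * M \<le> card A2"
    using split[OF fin(1) card(1)] by auto
  obtain B1 B2 where B12: "B1 \<subseteq> B - set p" "B2 \<subseteq> B - set p" "B1 \<inter> B2 = {}" "8 * M \<le> card B1" "8 * M \<le> card B2"
    using split[OF fin(2) card(2)] by auto
  have fAB: "finite A1" "finite A2" "finite B1" "finite B2" using A12 B12 fin by (auto intro: finite_subset)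
  have h1: "no_hole E M A1 B1" "no_hole E M A2 B2" using A12 B12 by (auto intro!: no_hole_mono[OF hole])
  have d1: "A1 \<inter> B1 = {}" "A2 \<inter> B2 = {}" using A12 B12 dis by auto
  obtain P1 Q1 where R1: "P1 \<subseteq> A1" "Q1 \<subseteq> B1" "M \<le> card P1" "M \<le> card Q1"
     "\<forall>x\<in>P1. \<exists>L. L \<subseteq> (if even h then A1 else B1) \<and> M \<le> card L \<and> reached E (A1 \<union> B1) h x L"
     "\<forall>x\<in>Q1. \<exists>L. L \<subseteq> (if even h then B1 else A1) \<and> M \<le> card L \<and> reached E (A1 \<union> B1) h x L"
    using expanding_region[OF fAB(1,3) d1(1) sym h1(1) A12(4) B12(4) \<open>M > 0\<close> h] by metis
  obtain P2 Q2 where R2: "P2 \<subseteq> A2" "Q2 \<subseteq> B2" "M \<le> card P2" "M \<le> card Q2"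
     "\<forall>x\<in>P2. \<exists>L. L \<subseteq> (if even h then A2 else B2) \<and> M \<le> card L \<and> reached E (A2 \<union> B2) h x L"
     "\<forall>x\<in>Q2. \<exists>L. L \<subseteq> (if even h then B2 else A2) \<and> M \<le> card L \<and> reached E (A2 \<union> B2) h x L"
    using expanding_region[OF fAB(2,4) d1(2) sym h1(2) A12(5) B12(5) \<open>M > 0\<close> h] by metis
  \<comment> \<open>A vertex of the path outside \<open>bad P Q\<close> has a neighbour in whichever
    of \<open>P\<close> and \<open>Q\<close> lies on the opposite side. By the hole condition each
    side contributes fewer than \<open>M\<close> bad vertices, so the two regions together spoil
    fewer than \<open>4 * M\<close> positions.\<close>
  define bad where "bad P Q = {v \<in> set p. v \<in> A \<and> (\<forall>q\<in>Q. \<not> E v q) \<or> v \<in> B \<and> (\<forall>q\<in>P. \<not> E v q)}" for P Q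
  have bad: "card (bad P Q) < 2 * M" if "P \<subseteq> A" "Q \<subseteq> B" "M \<le> card P" "M \<le> card Q" for P Q
  proof -
    let ?SA = "{v \<in> set p. v \<in> A \<and> (\<forall>q\<in>Q. \<not> E v q)}" and ?SB = "{v \<in> set p. v \<in> B \<and> (\<forall>q\<in>P. \<not> E v q)}"
    have "card ?SA < M"
      using no_holeD[OF hole, of ?SA Q] that by fastforce
    moreover have "card ?SB < M"
      using no_holeD[OF no_hole_sym[OF sym hole], of ?SB P] that by fastforce
    moreover have "bad P Q = ?SA \<union> ?SB" by (auto simp: bad_def)
    ultimately show ?thesis using card_Un_le[of ?SA ?SB] by simp
  qed
  have idx: "card {i \<in> {..<4 * M}. p ! (i + d) \<in> X} \<le> card X" if "finite X" "d \<le> M" for X d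
  proof (rule card_inj_on_le[where f = "\<lambda>i. p ! (i + d)"])
    show "inj_on (\<lambda>i. p ! (i + d)) {i \<in> {..<4 * M}. p ! (i + d) \<in> X}"
      using that p distp by (auto simp: inj_on_def nth_eq_iff_index_eq)
  qed (use that in auto)
  let ?I1 = "{i \<in> {..<4 * M}. p ! (i + 0) \<in> bad P1 Q1}" and ?I2 = "{i \<in> {..<4 * M}. p ! (i + k) \<in> bad P2 Q2}"
  have fb: "finite (bad P Q)" for P Q by (simp add: bad_def)
  have "card ?I1 \<le> card (bad P1 Q1)" by (rule idx) (simp_all add: fb)
  moreover have "card (bad P1 Q1) < 2 * M" by (rule bad) (use R1 A12 B12 in auto)
  moreover have "card ?I2 \<le> card (bad P2 Q2)" by (rule idx) (simp_all add: fb k)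
  moreover have "card (bad P2 Q2) < 2 * M" by (rule bad) (use R2 A12 B12 in auto)
  ultimately have "card (?I1 \<union> ?I2) < card {..<4 * M}"
    using card_Un_le[of ?I1 ?I2] by simp
  then have "\<not> {..<4 * M} \<subseteq> ?I1 \<union> ?I2" 
    using card_mono[of "?I1 \<union> ?I2" "{..<4 * M}"] by auto
  then obtain i where i: "i < 4 * M" "p ! i \<notin> bad P1 Q1" "p ! (i + k) \<notin> bad P2 Q2" by auto
  have ik: "i + k < length p" using i k p by simp
  define u w where "u = p ! i" and "w = p ! (i + k)"
  have uw: "u \<in> set p" "w \<in> set p" using ik by (auto simp: u_def w_def)
  \<comment> \<open>Distance \<open>k\<close> means \<open>Suc k\<close> vertices. With two branches
    of \<open>Suc h\<close> vertices the total is \<open>2 * h + k + 3\<close>.\<close>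
  define q where "q = take (Suc k) (drop i p)"
  have q: "path E q" "length q = Suc k" "q \<noteq> []" "hd q = u" "last q = w" "set q \<subseteq> set p"
    using ik path_take[OF path_drop[OF pE]] set_take_subset[of "Suc k" "drop i p"] set_drop_subset[of i p]
    by (auto simp: q_def u_def w_def hd_drop_conv_nth last_conv_nth)
  have join: "\<exists>r. path E r \<and> set r \<subseteq> A \<union> B \<and> r \<noteq> [] \<and> length r = 2 * h + k + 3 \<and> hd r = y1 \<and> last r = y2"
    if r: "reached E (A1 \<union> B1) h x1 L1" "reached E (A2 \<union> B2) h x2 L2" "E u x1" "E w x2" "y1 \<in> L1" "y2 \<in> L2"
    for x1 x2 L1 L2 y1 y2
  proof -
    obtain q1 where q1: "path E q1" "q1 \<noteq> []" "hd q1 = y1" "last q1 = x1" "length q1 = Suc h" "set q1 \<subseteq> A1 \<union> B1"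
      using r unfolding reached_def by blast
    obtain q2 where q2: "path E q2" "q2 \<noteq> []" "hd q2 = y2" "last q2 = x2" "length q2 = Suc h" "set q2 \<subseteq> A2 \<union> B2"
      using r unfolding reached_def by blast
    have "(A1 \<union> B1) \<inter> set p = {}" "(A2 \<union> B2) \<inter> set p = {}" "(A1 \<union> B1) \<inter> (A2 \<union> B2) = {}"
      using A12 B12 dis by blast+
    then have dj: "set q1 \<inter> set q = {}" "set (q1 @ q) \<inter> set (rev q2) = {}"
      using q1(6) q2(6) q(6) unfolding set_append set_rev by blast+
    have "path E (q1 @ q)"
      using q1 q r sym dj by (intro path_append) (auto dest: sympD)
    then have "path E ((q1 @ q) @ rev q2)"
    proof (rule path_append)
      show "path E (rev q2)" by (rule path_rev[OF sym q2(1)])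
      show "set (q1 @ q) \<inter> set (rev q2) = {}" by (rule dj)
      show "E (last (q1 @ q)) (hd (rev q2))" using q q2 r by (simp add: hd_rev)
    qed
    then show ?thesis using q1 q2 q p A12 B12
      by (intro exI[of _ "(q1 @ q) @ rev q2"]) (auto simp: last_rev)
  qed
  \<comment> \<open>As \<open>u\<close> and \<open>w\<close> lie on opposite sides, so do the two
    roots, and, the depths being equal, the two sets of leaves. Which set is in \<open>A\<close>
    depends on the side of \<open>u\<close> and the parity of \<open>h\<close>; reversing the paths
    removes this ambiguity at the end.\<close>
  have "\<exists>L1 L2. (L1 \<subseteq> A \<and> L2 \<subseteq> B \<or> L1 \<subseteq> B \<and> L2 \<subseteq> A) \<and> M \<le> card L1 \<and> M \<le> card L2 \<and>
    (\<forall>x\<in>L1. \<forall>y\<in>L2. \<exists>p. path E p \<and> set p \<subseteq> A \<union> B \<and> p \<noteq> [] \<and> length p = 2 * h + k + 3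
        \<and> hd p = x \<and> last p = y)"
  proof (cases "u \<in> A")
    case True
    then have "w \<in> B" using alternating_nth[of ?F p A B i k] pF dis ik k by (auto simp: u_def w_def path_def)
    with True i uw obtain x1 x2 where x: "x1 \<in> Q1" "E u x1" "x2 \<in> P2" "E w x2"
      by (auto simp: bad_def u_def w_def)
    obtain L1 L2 where L: "L1 \<subseteq> (if even h then B1 else A1)" "M \<le> card L1" "reached E (A1 \<union> B1) h x1 L1"
       "L2 \<subseteq> (if even h then A2 else B2)" "M \<le> card L2" "reached E (A2 \<union> B2) h x2 L2"
      using R1(6) R2(5) x by metis
    have "L1 \<subseteq> A \<and> L2 \<subseteq> B \<or> L1 \<subseteq> B \<and> L2 \<subseteq> A"
      using L(1,4) A12(1,2) B12(1,2) by (cases "even h") auto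
    with L(2,5) join[OF L(3,6) x(2,4)] show ?thesis by metis
  next
    case False
    then have "u \<in> B" using uw p by auto
    then have "w \<in> A" using alternating_nth[of ?F p B A i k] pF dis ik k by (auto simp: u_def w_def path_def)
    with \<open>u \<in> B\<close> i uw obtain x1 x2 where x: "x1 \<in> P1" "E u x1" "x2 \<in> Q2" "E w x2"
      by (auto simp: bad_def u_def w_def)
    obtain L1 L2 where L: "L1 \<subseteq> (if even h then A1 else B1)" "M \<le> card L1" "reached E (A1 \<union> B1) h x1 L1"
       "L2 \<subseteq> (if even h then B2 else A2)" "M \<le> card L2" "reached E (A2 \<union> B2) h x2 L2"
      using R1(5) R2(6) x by metis
    have "L1 \<subseteq> A \<and> L2 \<subseteq> B \<or> L1 \<subseteq> B \<and> L2 \<subseteq> A"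
      using L(1,4) A12(1,2) B12(1,2) by (cases "even h") auto
    with L(2,5) join[OF L(3,6) x(2,4)] show ?thesis by metis
  qed
  then obtain L1 L2 where L: "L1 \<subseteq> A \<and> L2 \<subseteq> B \<or> L1 \<subseteq> B \<and> L2 \<subseteq> A" "M \<le> card L1" "M \<le> card L2"
    and pp: "\<forall>x\<in>L1. \<forall>y\<in>L2. \<exists>p. path E p \<and> set p \<subseteq> A \<union> B \<and> p \<noteq> []
        \<and> length p = 2 * h + k + 3 \<and> hd p = x \<and> last p = y"
    by metis
  have qq: "\<exists>p. path E p \<and> set p \<subseteq> A \<union> B \<and> p \<noteq> [] \<and> length p = 2 * h + k + 3
        \<and> hd p = y \<and> last p = x" if xy: "x\<in>L1" "y\<in>L2" for x y
  proof -
    obtain r where r: "path E r" "set r \<subseteq> A \<union> B" "r \<noteq> []" "length r = 2 * h + k + 3" "hd r = x" "last r = y"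
      using pp xy by metis
    then show ?thesis using path_rev[OF sym r(1)] by (intro exI[of _ "rev r"]) (auto simp: hd_rev last_rev)
  qed
  from L(1) show ?thesis
  proof
    assume "L1 \<subseteq> A \<and> L2 \<subseteq> B"
    with L(2,3) pp show ?thesis by metis
  next
    assume "L1 \<subseteq> B \<and> L2 \<subseteq> A"
    with L(2,3) qq show ?thesis by metis
  qed
qed

section \<open>Cycles of prescribed length\<close>

definition has_cycle :: "('a \<Rightarrow> 'a \<Rightarrow> bool) \<Rightarrow> nat \<Rightarrow> bool" where
  "has_cycle E n \<longleftrightarrow> (\<exists>p. path E p \<and> length p = n \<and> p \<noteq> [] \<and> E (last p) (hd p))"

text \<open>The factor \<open>4\<close> between \<open>M\<close> and \<open>2 ^ J\<close> gives
  depth at most \<open>J - 2\<close>, hence \<open>2 * h + 6 \<le> 2 * J + 2 \<le> n\<close>. This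
  slack leaves a positive distance \<open>k\<close> in both kinds of cycles.\<close>

lemma tree_depth:
  fixes M J n :: nat
  assumes "4 * M \<le> 2 ^ J" "0 < M" "2 * J + 2 \<le> n"
  shows "\<exists>h. M \<le> 2 ^ h \<and> (\<forall>i<h. 2 ^ i \<le> M) \<and> 2 * h + 6 \<le> n"
proof -
  have "2 \<le> J"
  proof (rule ccontr)
    assume "\<not> 2 \<le> J"
    then have "J = 0 \<or> J = 1" by auto
    with assms show False by auto
  qed
  then obtain j where j: "J = Suc (Suc j)" by (metis Suc_le_D numeral_2_eq_2 Suc_le_mono)
  define h where "h = (LEAST h. M \<le> 2 ^ h)"
  have M: "M \<le> 2 ^ j" using assms j by simp
  then have "h \<le> j" unfolding h_def by (rule Least_le)
  moreover have "M \<le> 2 ^ h" unfolding h_def by (rule LeastI[of _ j]) (rule M)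
  moreover have "2 ^ i \<le> M" if "i < h" for i using not_less_Least[of i "\<lambda>h. M \<le> 2 ^ h"] that by (simp add: h_def)
  ultimately show ?thesis using assms j by (intro exI[of _ h]) auto
qed

lemma has_even_cycle:
  assumes fin: "finite A" "finite B" and dis: "A \<inter> B = {}" and sym: "symp E"
    and hole: "no_hole E M A B" and card: "22 * M \<le> card A" "22 * M \<le> card B" and "M > 0"
    and J: "card A \<le> 2 ^ J" "2 * J + 2 \<le> n" and n: "even n" "n \<le> M"
  shows "has_cycle E n"
proof -
  obtain h where h: "M \<le> 2 ^ h" "\<forall>i<h. 2 ^ i \<le> M" "2 * h + 6 \<le> n"
    using tree_depth[of M J n] J card \<open>M > 0\<close> by auto
  define k where "k = n - (2 * h + 3)"
  have k: "odd k" "k \<le> M" "2 * h + k + 3 = n" using h n by (auto simp: k_def)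
  obtain L1 L2 where L: "L1 \<subseteq> A" "L2 \<subseteq> B" "M \<le> card L1" "M \<le> card L2"
    and pp: "\<forall>x\<in>L1. \<forall>y\<in>L2. \<exists>p. path E p \<and> set p \<subseteq> A \<union> B \<and> p \<noteq> [] \<and> length p = 2 * h + k + 3
        \<and> hd p = x \<and> last p = y"
    using connecting_paths[OF fin dis sym hole card \<open>M > 0\<close> h(1,2) k(1,2)] by metis
  obtain x y where xy: "x \<in> L1" "y \<in> L2" "E x y" using no_holeD[OF hole L] by auto
  with pp obtain p where "path E p" "p \<noteq> []" "length p = n" "hd p = x" "last p = y" using k by metis
  with xy sym show ?thesis unfolding has_cycle_def by (metis sympD)
qed

lemma has_odd_cycle:
  assumes fin: "finite A" "finite B" "finite C" and dis: "A \<inter> B = {}" "A \<inter> C = {}" "B \<inter> C = {}"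
    and sym: "symp E" and hole: "no_hole E M A B" "no_hole E M A C" "no_hole E M B C"
    and card: "22 * M \<le> card A" "22 * M \<le> card B" "2 * M \<le> card C" and "M > 0"
    and J: "card A \<le> 2 ^ J" "2 * J + 2 \<le> n" and n: "odd n" "n \<le> M"
  shows "has_cycle E n"
proof -
  obtain h where h: "M \<le> 2 ^ h" "\<forall>i<h. 2 ^ i \<le> M" "2 * h + 6 \<le> n"
    using tree_depth[of M J n] J card \<open>M > 0\<close> by auto
  \<comment> \<open>One vertex of \<open>C\<close> is added to the \<open>2 * h + k + 3\<close>
    vertices of the path, so now an odd \<open>n\<close> makes \<open>k\<close> odd.\<close>
  define k where "k = n - (2 * h + 4)"
  have k: "odd k" "k \<le> M" "2 * h + k + 4 = n" using h n by (auto simp: k_def)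
  obtain L1 L2 where L: "L1 \<subseteq> A" "L2 \<subseteq> B" "M \<le> card L1" "M \<le> card L2"
    and pp: "\<forall>x\<in>L1. \<forall>y\<in>L2. \<exists>p. path E p \<and> set p \<subseteq> A \<union> B \<and> p \<noteq> [] \<and> length p = 2 * h + k + 3
        \<and> hd p = x \<and> last p = y"
    using connecting_paths[OF fin(1,2) dis(1) sym hole(1) card(1,2) \<open>M > 0\<close> h(1,2) k(1,2)] by metis
  \<comment> \<open>Fewer than \<open>M\<close> vertices of \<open>C\<close> miss \<open>L1\<close>
    and fewer than \<open>M\<close> miss \<open>L2\<close>; the size \<open>2 * M\<close> of
    \<open>C\<close> leaves a common neighbour.\<close>
  let ?C1 = "{z \<in> C. \<forall>x\<in>L1. \<not> E x z}" and ?C2 = "{z \<in> C. \<forall>x\<in>L2. \<not> E x z}"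
  have "card ?C1 < M" using no_holeD[OF hole(2) L(1), of ?C1] L by fastforce
  moreover have "card ?C2 < M" using no_holeD[OF hole(3) L(2), of ?C2] L by fastforce
  ultimately have "card (?C1 \<union> ?C2) < card C" using card_Un_le[of ?C1 ?C2] card by simp
  then have "\<not> C \<subseteq> ?C1 \<union> ?C2" 
    using card_mono[of "?C1 \<union> ?C2" C] fin by auto
  then obtain z x y where z: "z \<in> C" "x \<in> L1" "E x z" "y \<in> L2" "E y z" by auto
  with pp obtain p where p: "path E p" "p \<noteq> []" "length p = 2 * h + k + 3" "hd p = x" "last p = y"
    "set p \<subseteq> A \<union> B" by metis
  have "path E (z # p)" using p z dis sym by (intro path_Cons) (auto dest: sympD)
  with p z k show ?thesis unfolding has_cycle_def by (intro exI[of _ "z # p"]) auto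
qed

section \<open>Eliminating the cycle colours\<close>

definition avoids :: "('i \<Rightarrow> 'a \<Rightarrow> 'a \<Rightarrow> bool) \<Rightarrow> 'i set \<Rightarrow> 'a set \<Rightarrow> 'a set \<Rightarrow> bool" where
  "avoids E I A B \<longleftrightarrow> (\<forall>i\<in>I. \<forall>a\<in>A. \<forall>b\<in>B. \<not> E i a b)"

lemma avoids_mono: "avoids E I A B \<Longrightarrow> A' \<subseteq> A \<Longrightarrow> B' \<subseteq> B \<Longrightarrow> avoids E I A' B'"
  unfolding avoids_def by blast

lemma hole_extends_avoids:
  assumes "avoids E I A B" "\<not> no_hole (E i) M A B"
  shows "\<exists>S T. S \<subseteq> A \<and> T \<subseteq> B \<and> M \<le> card S \<and> M \<le> card T \<and> avoids E (insert i I) S T"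
proof -
  from assms(2) obtain S T where "S \<subseteq> A" "T \<subseteq> B" "M \<le> card S" "M \<le> card T" "\<forall>s\<in>S. \<forall>t\<in>T. \<not> E i s t"
    unfolding no_hole_def by blast
  moreover from this have "avoids E (insert i I) S T"
    using avoids_mono[OF assms(1)] by (auto simp: avoids_def)
  ultimately show ?thesis by metis
qed

text \<open>Each colour costs one factor \<open>81\<close>, which exceeds the \<open>22\<close> that
  \<open>has_even_cycle\<close> asks for. The ambient set \<open>V0\<close> bounds all sets of the
  recursion, so one \<open>J\<close> serves for every colour.\<close>

lemma even_colours:
  fixes n :: "'i \<Rightarrow> nat"
  assumes "finite I" and fin: "finite V0" and J: "card V0 \<le> 2 ^ J" and sym: "\<And>i. symp (E i)"
    and "\<forall>i\<in>I. even (n i) \<and> 2 * J + 2 \<le> n i \<and> n i \<le> M \<and> \<not> has_cycle (E i) (n i)"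
    and "A \<subseteq> V0" "B \<subseteq> V0" "A \<inter> B = {}" "81 ^ card I * M \<le> card A" "81 ^ card I * M \<le> card B" "0 < M"
  shows "\<exists>S T. S \<subseteq> A \<and> T \<subseteq> B \<and> M \<le> card S \<and> M \<le> card T \<and> avoids E I S T"
  using assms(1,5-)
proof (induction I arbitrary: A B)
  case empty
  then show ?case by (auto simp: avoids_def)
next
  case (insert i I)
  let ?M = "81 ^ card I * M"
  have M: "M \<le> ?M" by simp
  have fAB: "finite A" "finite B" using insert.prems fin finite_subset by auto
  have "\<not> no_hole (E i) ?M A B"
  proof
    assume "no_hole (E i) ?M A B"
    moreover have "card A \<le> 2 ^ J" using J insert.prems fin card_mono order_trans by metis
    moreover have "n i \<le> ?M" using insert.prems M by (meson insertI1 order_trans)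
    ultimately have "has_cycle (E i) (n i)"
      using insert.prems insert.hyps fAB sym[of i]
      by (intro has_even_cycle[of A B "E i" ?M J]) auto
    with insert.prems show False by simp
  qed
  then obtain S T where ST: "S \<subseteq> A" "T \<subseteq> B" "?M \<le> card S" "?M \<le> card T" "avoids E {i} S T"
    using hole_extends_avoids[of E "{}" A B i ?M] by (auto simp: avoids_def)
  have "\<exists>S' T'. S' \<subseteq> S \<and> T' \<subseteq> T \<and> M \<le> card S' \<and> M \<le> card T' \<and> avoids E I S' T'"
    by (rule insert.IH) (use insert.prems ST in auto)
  then obtain S' T' where "S' \<subseteq> S" "T' \<subseteq> T" "M \<le> card S'" "M \<le> card T'" "avoids E I S' T'" by auto
  moreover from this have "avoids E (insert i I) S' T'"
    using avoids_mono[OF ST(5)] by (auto simp: avoids_def)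
  ultimately show ?case using ST(1,2) by (meson order_trans)
qed

text \<open>The case \<open>46 = 22 + 22 + 2\<close> is that of a triple chosen arbitrarily.\<close>
fun odd_factor :: "nat \<Rightarrow> nat" where
  "odd_factor 0 = 2"
| "odd_factor (Suc 0) = 46"
| "odd_factor (Suc (Suc t)) = 22 * (odd_factor (Suc t))\<^sup>2"

lemma odd_factor_ge: "2 \<le> odd_factor t"
  by (induction t rule: odd_factor.induct) (auto simp: power2_eq_square intro: order_trans[OF _ mult_le_mono[of 2 _ 2]])

text \<open>Applying the induction hypothesis first to \<open>V\<close> and then inside one of the two sets obtained
  yields three sets whose pairs all avoid the colours in \<open>I\<close>; if none of these pairs contains a
  hole in the new colour, then that colour contains an odd cycle through all three sets.\<close>
lemma odd_colours:
  fixes n :: "'i \<Rightarrow> nat"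
  assumes "finite I" and fin: "finite V0" and J: "card V0 \<le> 2 ^ J" and sym: "\<And>i. symp (E i)"
    and "\<forall>i\<in>I. odd (n i) \<and> 2 * J + 2 \<le> n i \<and> n i \<le> M \<and> \<not> has_cycle (E i) (n i)"
    and "V \<subseteq> V0" "odd_factor (card I) * M \<le> card V" "0 < M"
  shows "\<exists>A B. A \<subseteq> V \<and> B \<subseteq> V \<and> A \<inter> B = {} \<and> M \<le> card A \<and> M \<le> card B \<and> avoids E I A B"
  using assms(1,5-)
proof (induction I arbitrary: V M)
  case empty
  then show ?case
    using two_disjoint_subsets[of V M] fin finite_subset[of V V0] by (auto simp: avoids_def)
next
  case (insert i I)
  have fV: "finite V" using insert.prems fin finite_subset by auto
  have "\<exists>A B C. A \<subseteq> V \<and> B \<subseteq> V \<and> C \<subseteq> V \<and> A \<inter> B = {} \<and> A \<inter> C = {} \<and> B \<inter> C = {} \<and>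
     22 * M \<le> card A \<and> 22 * M \<le> card B \<and> 2 * M \<le> card C \<and>
     avoids E I A B \<and> avoids E I A C \<and> avoids E I B C"
  proof (cases "I = {}")
    case True
    with insert.prems have V: "46 * M \<le> card V" by simp
    obtain A where A: "A \<subseteq> V" "card A = 22 * M" "finite A"
      by (rule obtain_subset_with_card_n[of "22 * M" V]) (use V in auto)
    then have "24 * M \<le> card (V - A)" using V by (simp add: card_Diff_subset)
    obtain B where B: "B \<subseteq> V - A" "card B = 22 * M" "finite B"
      by (rule obtain_subset_with_card_n[of "22 * M" "V - A"]) (use \<open>24 * M \<le> _\<close> in auto)
    then have "2 * M \<le> card (V - A - B)" using \<open>24 * M \<le> _\<close> by (simp add: card_Diff_subset)
    show ?thesis
      by (rule exI[of _ A], rule exI[of _ B], rule exI[of _ "V - A - B"])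
        (use A B True \<open>2 * M \<le> card (V - A - B)\<close> in \<open>auto simp: avoids_def\<close>)
  next
    case False
    define g where "g = odd_factor (card I)"
    have g: "2 \<le> g" using odd_factor_ge by (simp add: g_def)
    \<comment> \<open>For a successor, \<open>odd_factor (Suc (card I))\<close> is
      \<open>22 * g\<^sup>2\<close>: one factor \<open>g\<close> pays for splitting \<open>V\<close>
      into \<open>W\<close> and \<open>C\<close> of size \<open>22 * g * M\<close>, the other for
      splitting \<open>W\<close> into sets of size \<open>22 * M\<close>.\<close>
    have "card I \<noteq> 0" using False insert.hyps by simp
    then obtain t where "card I = Suc t" using not0_implies_Suc by blast
    then have V: "g * (22 * g * M) \<le> card V"
      using insert.prems insert.hyps by (simp add: g_def power2_eq_square algebra_simps)
    have "\<exists>A B. A \<subseteq> V \<and> B \<subseteq> V \<and> A \<inter> B = {} \<and> 22 * g * M \<le> card A \<and> 22 * g * M \<le> card B \<and> avoids E I A B"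
      by (rule insert.IH)
        (use insert.prems V g in \<open>auto simp flip: g_def intro: order_trans[of _ M]\<close>)
    then obtain W C where WC: "W \<subseteq> V" "C \<subseteq> V" "W \<inter> C = {}" "22 * g * M \<le> card W" "22 * g * M \<le> card C"
      "avoids E I W C" by auto
    have "\<exists>A B. A \<subseteq> W \<and> B \<subseteq> W \<and> A \<inter> B = {} \<and> 22 * M \<le> card A \<and> 22 * M \<le> card B \<and> avoids E I A B"
      by (rule insert.IH)
        (use insert.prems WC in \<open>auto simp: mult.commute mult.left_commute simp flip: g_def intro: order_trans[of _ M]\<close>)
    then obtain A B where AB: "A \<subseteq> W" "B \<subseteq> W" "A \<inter> B = {}" "22 * M \<le> card A" "22 * M \<le> card B" "avoids E I A B"
      by auto
    have "2 * M \<le> 22 * g * M" using g by simp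
    then have "2 * M \<le> card C" using WC by linarith
    moreover have "avoids E I A C" "avoids E I B C" using avoids_mono[OF WC(6)] AB by auto
    moreover have "A \<subseteq> V" "B \<subseteq> V" "A \<inter> C = {}" "B \<inter> C = {}" using AB(1,2) WC(1,3) by auto
    ultimately show ?thesis using AB(3-6) WC(2) by metis
  qed
  then obtain A B C where ABC: "A \<subseteq> V" "B \<subseteq> V" "C \<subseteq> V" "A \<inter> B = {}" "A \<inter> C = {}" "B \<inter> C = {}"
     "22 * M \<le> card A" "22 * M \<le> card B" "2 * M \<le> card C"
     and av: "avoids E I A B" "avoids E I A C" "avoids E I B C" by metis
  have fABC: "finite A" "finite B" "finite C" using ABC(1-3) fV by (auto intro: finite_subset)
  have "A \<subseteq> V0" using ABC(1) insert.prems by auto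
  then have "card A \<le> 2 ^ J" using card_mono[OF fin] J order_trans by blast
  then have "\<not> (no_hole (E i) M A B \<and> no_hole (E i) M A C \<and> no_hole (E i) M B C)"
    using has_odd_cycle[OF fABC ABC(4-6) sym _ _ _ ABC(7-9), of i J "n i"] insert.prems by auto
  then obtain X Y where XY: "X \<subseteq> V" "Y \<subseteq> V" "X \<inter> Y = {}" "avoids E I X Y" "\<not> no_hole (E i) M X Y"
    using ABC av by metis
  then obtain S T where "S \<subseteq> X" "T \<subseteq> Y" "M \<le> card S" "M \<le> card T" "avoids E (insert i I) S T"
    using hole_extends_avoids[OF XY(4,5)] by auto
  moreover from this XY have "S \<subseteq> V" "T \<subseteq> V" "S \<inter> T = {}" by auto
  ultimately show ?case by metis
qed

text \<open>Multiplied by \<open>22\<close>, the recursion becomes pure squaring, and it starts at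
  \<open>22 * 46 = 1012\<close>, below \<open>1225 = 35\<^sup>2\<close>. The estimate then follows
  from \<open>1225 \<le> 22 * 82\<close>. For \<open>t = 0\<close> the exponent is
  \<open>-1\<close>, and \<open>82 / 35\<close> exceeds \<open>2\<close>.\<close>

lemma odd_factor_le: "82 * (35::real) powr (2 ^ t - 2) \<ge> odd_factor t"
proof (cases t)
  case 0
  then show ?thesis by (simp add: powr_minus)
next
  case (Suc s)
  have "22 * odd_factor (Suc s) \<le> 1225 ^ (2 ^ s)"
  proof (induction s)
    case (Suc s)
    have "22 * odd_factor (Suc (Suc s)) = (22 * odd_factor (Suc s))\<^sup>2" by (simp add: power2_eq_square)
    also have "\<dots> \<le> (1225 ^ (2 ^ s))\<^sup>2" using Suc by (intro power_mono) auto
    also have "\<dots> = 1225 ^ (2 ^ Suc s)" by (simp flip: power_mult add: mult.commute)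
    finally show ?case .
  qed simp
  then have "real (22 * odd_factor t) \<le> real (1225 ^ (2 ^ s))" using Suc of_nat_le_iff by blast
  moreover have "(35::real) powr (2 ^ t - 2) = 1225 ^ (2 ^ s) / 1225"
  proof -
    have "(35::real) powr (2 ^ t) = 35 ^ (2 ^ t)"
      using powr_realpow[of "35::real" "2 ^ t"] by simp
    also have "\<dots> = (35\<^sup>2) ^ (2 ^ s)" by (simp only: Suc power_Suc power_mult)
    finally show ?thesis by (simp add: powr_diff)
  qed
  ultimately show ?thesis by simp
qed

section \<open>Monochromatic copies and the Ramsey bound\<close>

lemma has_cycle_mono_copy:
  assumes "has_cycle (\<lambda>x y. x < N \<and> y < N \<and> x \<noteq> y \<and> c x y = i) n" "is_coloring N k c"
  shows "mono_copy N c i (cycle_graph n)"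
proof -
  let ?E = "\<lambda>x y. x < N \<and> y < N \<and> x \<noteq> y \<and> c x y = i"
  obtain p where p: "path ?E p" "length p = n" "p \<noteq> []" "?E (last p) (hd p)"
    using assms unfolding has_cycle_def by blast
  have adj: "?E (p ! j) (p ! ((j + 1) mod n))" if "j < n" for j
  proof (cases "Suc j < n")
    case True
    then show ?thesis using p successively_nth[of ?E p j] by (auto simp: path_def)
  next
    case False
    then have "Suc j = n" using that by simp
    then show ?thesis using p by (auto simp: last_conv_nth hd_conv_nth)
  qed
  have sym: "c x y = c y x" if "x < N" "y < N" for x y
    using assms(2) that unfolding is_coloring_def by metis
  have "c (p ! u) (p ! v) = i" if uv: "{u, v} = {j, (j + 1) mod n}" "j < n" for u v j
    using adj[OF uv(2)] uv(1) sym by (auto simp: doubleton_eq_iff)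
  then show ?thesis using p adj
    unfolding mono_copy_def cycle_graph_def path_def
    by (intro exI[of _ "\<lambda>j. p ! j"]) (auto simp: inj_on_def nth_eq_iff_index_eq)
qed

lemma complete_bipartite_mono_copy:
  assumes A: "A \<subseteq> {..<N}" "m \<le> card A" and B: "B \<subseteq> {..<N}" "m \<le> card B" and dis: "A \<inter> B = {}"
    and c: "\<And>a b. a \<in> A \<Longrightarrow> b \<in> B \<Longrightarrow> c a b = i" and "is_coloring N k c"
  shows "mono_copy N c i (complete_bipartite m)"
proof -
  have "\<exists>f. inj_on f {..<m} \<and> f ` {..<m} \<subseteq> X" if "m \<le> card X" "X \<subseteq> {..<N}" for X
    using card_le_inj[of "{..<m}" X] that finite_subset[of X "{..<N}"] by auto
  then obtain f g where f: "inj_on f {..<m}" "f ` {..<m} \<subseteq> A" and g: "inj_on g {..<m}" "g ` {..<m} \<subseteq> B"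
    using A B by metis
  define e where "e u = (if u < m then f u else g (u - m))" for u
  have eA: "e u \<in> A" if "u < m" for u using that f by (auto simp: e_def)
  have eB: "e (m + u) \<in> B" if "u < m" for u using that g by (auto simp: e_def)
  have eB': "e u \<in> B" if "\<not> u < m" "u < 2 * m" for u using that eB[of "u - m"] by simp
  have sym: "c x y = c y x" if "x < N" "y < N" for x y
    using assms(7) that unfolding is_coloring_def by metis
  have "inj_on e {0..<2 * m}"
  proof (rule inj_onI)
    fix u v assume uv: "u \<in> {0..<2 * m}" "v \<in> {0..<2 * m}" "e u = e v"
    then have "u < m \<longleftrightarrow> v < m" using eA eB' dis by (metis atLeastLessThan_iff disjoint_iff)
    then consider "u < m" "v < m" | "m \<le> u" "m \<le> v" by linarith
    then show "u = v"
    proof cases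
      case 1
      then show ?thesis using uv(3) inj_onD[OF f(1), of u v] by (simp add: e_def)
    next
      case 2
      then have "u - m < m" "v - m < m" using uv by auto
      then have "u - m = v - m" using 2 uv(3) inj_onD[OF g(1), of "u - m" "v - m"] by (simp add: e_def)
      with 2 show ?thesis by simp
    qed
  qed
  moreover have "e u \<in> {..<N}" if "u < 2 * m" for u
    using eA[of u] eB'[of u] A(1) B(1) that by (cases "u < m") auto
  then have "e ` {0..<2 * m} \<subseteq> {..<N}" by auto
  moreover have "c (e u) (e v) = i" if "{u, v} = {a, m + b}" "a < m" "b < m" for u v a b
  proof -
    have ab: "e a \<in> A" "e (m + b) \<in> B" using eA eB that by auto
    then have "c (e a) (e (m + b)) = i" "c (e (m + b)) (e a) = i" using c sym A B by (auto simp: subset_iff)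
    then show ?thesis using that by (auto simp: doubleton_eq_iff)
  qed
  ultimately show ?thesis unfolding mono_copy_def complete_bipartite_def by (intro exI[of _ e]) auto
qed

theorem theorem2p12:
  fixes ns :: "nat list" and m :: nat and N :: real
  assumes "\<forall>n \<in> set ns. n > 0"
    and "m > 0"
    and "N = 82 * 35 powr (2 ^ length (filter odd ns) - 2)
              * 81 ^ length (filter even ns) * real m"
    and "\<forall>n \<in> set ns. real m \<ge> real n \<and> real n \<ge> 2 * (real_of_int \<lceil>log 2 N\<rceil> + 1)"
  shows "real (ramsey_number (map cycle_graph ns @ [complete_bipartite m])) \<le> N"
proof -
  let ?Gs = "map cycle_graph ns @ [complete_bipartite m]"
  let ?t = "length ns"
  define Io where "Io = {i. i < ?t \<and> odd (ns ! i)}"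
  define Ie where "Ie = {i. i < ?t \<and> even (ns ! i)}"
  have cI: "card Io = length (filter odd ns)" "card Ie = length (filter even ns)"
    by (simp_all add: Io_def Ie_def length_filter_conv_card)
  \<comment> \<open>The bound \<open>N\<close> is real and need not be an integer; the Ramsey
    property is shown for its integer part.\<close>
  define K where "K = nat \<lfloor>N\<rfloor>"
  define J where "J = nat \<lceil>log 2 N\<rceil>"
  let ?M = "81 ^ card Ie * m"
  have "real (odd_factor (card Io) * ?M) = real (odd_factor (card Io)) * 81 ^ card Ie * real m" by simp
  also have "\<dots> \<le> N" unfolding assms(3) cI
    by (intro mult_right_mono odd_factor_le) auto
  finally have NM: "real (odd_factor (card Io) * ?M) \<le> N" .
  then have KM: "odd_factor (card Io) * ?M \<le> K" unfolding K_def by (simp add: le_nat_floor)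
  have "1 * 1 \<le> odd_factor (card Io) * ?M"
    using odd_factor_ge[of "card Io"] \<open>m > 0\<close> by (intro mult_le_mono) auto
  \<comment> \<open>This makes \<open>log 2 N\<close> nonnegative, so \<open>nat\<close> in
    \<open>J\<close> truncates nothing and \<open>K \<le> N \<le> 2 ^ J\<close>.\<close>
  then have N1: "1 \<le> N" using NM by linarith
  have KN: "real K \<le> N" using N1 unfolding K_def by simp
  have "0 \<le> log 2 N" using N1 by simp
  then have J: "real J = real_of_int \<lceil>log 2 N\<rceil>" unfolding J_def by simp
  have "N = 2 powr (log 2 N)" using N1 by simp
  also have "\<dots> \<le> 2 powr (real J)" unfolding J by (intro powr_mono) auto
  also have "\<dots> = real (2 ^ J)" by (simp add: powr_realpow)
  finally have "real K \<le> real (2 ^ J)" using KN by (rule order_trans[rotated])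
  then have KJ: "K \<le> 2 ^ J" using of_nat_le_iff by blast
  have ns: "n \<le> m \<and> 2 * J + 2 \<le> n" if "n \<in> set ns" for n
  proof -
    have "real n \<le> real m" "2 * (real J + 1) \<le> real n" using assms(4) that J by auto
    moreover have "real (2 * J + 2) = 2 * (real J + 1)" by simp
    ultimately show ?thesis by (metis of_nat_le_iff)
  qed
  have "ramsey_prop ?Gs K"
    unfolding ramsey_prop_def
  proof (intro allI impI, rule ccontr)
    fix c assume c: "is_coloring K (length ?Gs) c" and no: "\<not> (\<exists>i<length ?Gs. mono_copy K c i (?Gs ! i))"
    define E where "E = (\<lambda>i x y. x < K \<and> y < K \<and> x \<noteq> y \<and> c x y = i)"
    have sym: "symp (E i)" for i using c by (auto simp: E_def symp_def is_coloring_def)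
    have nc: "\<not> has_cycle (E i) (ns ! i)" if "i < ?t" for i
    proof
      assume "has_cycle (E i) (ns ! i)"
      then have "mono_copy K c i (cycle_graph (ns ! i))"
        using has_cycle_mono_copy c unfolding E_def by blast
      with no that show False by (auto simp: nth_append less_Suc_eq)
    qed
    have M: "m \<le> ?M" "0 < ?M" using \<open>m > 0\<close> by auto
    \<comment> \<open>The odd colours go first with target size \<open>?M\<close>, which is what the
      even colours then consume to end with \<open>m\<close> vertices on each side.\<close>
    have "\<exists>A B. A \<subseteq> {..<K} \<and> B \<subseteq> {..<K} \<and> A \<inter> B = {} \<and> ?M \<le> card A \<and> ?M \<le> card B \<and> avoids E Io A B"
    proof (rule odd_colours[where J = J and n = "\<lambda>i. ns ! i" and ?V0.0 = "{..<K}"])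
      show "\<forall>i\<in>Io. odd (ns ! i) \<and> 2 * J + 2 \<le> ns ! i \<and> ns ! i \<le> ?M \<and> \<not> has_cycle (E i) (ns ! i)"
        using ns nc order_trans[OF _ M(1)] unfolding Io_def by auto
    qed (use sym KJ KM M in \<open>auto simp: Io_def\<close>)
    then obtain A B where AB: "A \<subseteq> {..<K}" "B \<subseteq> {..<K}" "A \<inter> B = {}" "?M \<le> card A" "?M \<le> card B"
      "avoids E Io A B" by metis
    have "\<exists>S T. S \<subseteq> A \<and> T \<subseteq> B \<and> m \<le> card S \<and> m \<le> card T \<and> avoids E Ie S T"
    proof (rule even_colours[where J = J and n = "\<lambda>i. ns ! i" and ?V0.0 = "{..<K}"])
      show "\<forall>i\<in>Ie. even (ns ! i) \<and> 2 * J + 2 \<le> ns ! i \<and> ns ! i \<le> m \<and> \<not> has_cycle (E i) (ns ! i)"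
        using ns nc unfolding Ie_def by auto
    qed (use sym KJ AB \<open>m > 0\<close> in \<open>auto simp: Ie_def\<close>)
    then obtain S T where ST: "S \<subseteq> A" "T \<subseteq> B" "m \<le> card S" "m \<le> card T" "avoids E Ie S T" by metis
    have "mono_copy K c ?t (complete_bipartite m)"
    proof (rule complete_bipartite_mono_copy[where A = S and B = T])
      fix a b assume ab: "a \<in> S" "b \<in> T"
      then have lt: "a < K" "b < K" "a \<noteq> b" using ST AB by auto
      then have "c a b < Suc ?t" using c by (simp add: is_coloring_def)
      \<comment> \<open>Every colour below \<open>?t\<close> is in \<open>Io\<close> or
        \<open>Ie\<close> and is avoided between \<open>S\<close> and \<open>T\<close>, so only the
        last colour remains.\<close>
      moreover have "\<not> c a b < ?t"
      proof
        assume "c a b < ?t"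
        then have "c a b \<in> Io \<union> Ie" by (auto simp: Io_def Ie_def)
        moreover have "E (c a b) a b" using lt by (simp add: E_def)
        ultimately show False using AB(6) ST ab unfolding avoids_def by blast
      qed
      ultimately show "c a b = ?t" by simp
    qed (use ST AB c in auto)
    with no show False by (auto simp: nth_append)
  qed
  then have "ramsey_number ?Gs \<le> K" unfolding ramsey_number_def by (rule Least_le)
  with KN show ?thesis by linarith
qed

end
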